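(* Let $K$ be a finite simplicial complex, and let $\mathcal{V}$ and $\mathcal{V}'$ be multivector fields on $K$ where $\mathcal{V}'$ is an atomic refinement of $\mathcal{V}$. Let $A \subseteq K$ be a $\mathcal{V}$-compatible and convex set. Then the pair $(\mathrm{cl}(A), \mathrm{mo}(A))$ is an index pair for both $\mathrm{Inv}_{\mathcal{V}}(A)$ under $\mathcal{V}$ and $\mathrm{Inv}_{\mathcal{V}'}(A)$ under $\mathcal{V}'$.
   Context: $K$ is a finite simplicial complex, viewed as the finite set of its (nonempty) simplices; $\leq$ is the face relation. Homology is simplicial homology with coefficients in a fixed finite field. Closure and mouth: $\mathrm{cl}(\sigma) = \{\tau \in K : \tau \leq \sigma\}$, $\mathrm{cl}(A) = \bigcup_{\sigma\in A}\mathrm{cl}(\sigma)$ for $A\subseteq K$; $A$ is closed if $A=\mathrm{cl}(A)$; $\mathrm{mo}(A) = \mathrm{cl}(A)\setminus A$. A set $A\subseteq K$ is convex if $\sigma\leq\rho\leq\tau$ with $\sigma,\tau\in A$, $\rho\in K$ implies $\rho\in A$. A multivector is a convex subset of $K$; a multivector field on $K$ is a partition of $K$ into multivectors. $[\sigma]_{\mathcal{V}}$ is the unique multivector of $\mathcal{V}$ containing $\sigma$. A multivector $V$ is critical if $H(\mathrm{cl}(V),\mathrm{mo}(V))\neq 0$. A set $A\subseteq K$ is $\mathcal{V}$-compatible if it is a union of multivectors of $\mathcal{V}$. Dynamics: $F_{\mathcal{V}}(\sigma)=\mathrm{cl}(\sigma)\cup[\sigma]_{\mathcal{V}}$, and $F_{\mathcal{V}}(A)=\bigcup_{\sigma\in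 A}F_{\mathcal{V}}(\sigma)$. A path is a map $\rho:\mathbb{Z}\cap[0,n]\to K$ with $\rho(i+1)\in F_{\mathcal{V}}(\rho(i))$ for $0\le i\le n-1$; a solution is a map $\rho:\mathbb{Z}\to K$ with $\rho(i+1)\in F_{\mathcal{V}}(\rho(i))$ for all $i\in\mathbb{Z}$. A solution $\rho$ is essential if for every $i$ with $[\rho(i)]_{\mathcal{V}}$ not critical there exist $i^-<i<i^+$ with $[\rho(i^-)]_{\mathcal{V}}\neq[\rho(i)]_{\mathcal{V}}\neq[\rho(i^+)]_{\mathcal{V}}$. Invariant sets: $\mathrm{Inv}_{\mathcal{V}}(A)$ is the set of $\sigma\in A$ for which there is an essential solution $\rho:\mathbb{Z}\to A$ (under $\mathcal{V}$) with $\rho(i)=\sigma$ for some $i$. $S$ is an invariant set under $\mathcal{V}$ if $S=\mathrm{Inv}_{\mathcal{V}}(S)$. An invariant set $S$ is an isolated invariant set under $\mathcal{V}$ if there is a closed set $N$ (an isolating set for $S$) with $F_{\mathcal{V}}(S)\subseteq N$ such that every path $\rho:\mathbb{Z}\cap[0,n]\to N$ with $\rho(0),\rho(n)\in S$ has its whole image in $S$. Index pair: for an isolated invariant set $S$ under $\mathcal{V}$ and closed sets $E\subseteq P\subseteq K$, $(P,E)$ is an index pair for $S$ (under $\mathcal{V}$) if (1) $F_{\mathcal{V}}(P\setminus E)\subseteq P$; (2) $F_{\mathcal{V}}(E)\cap P\subseteq E$; (3) $S=\mathrm{Inv}_{\mathcal{V}}(P\setminus E)$. Atomic refinement: $\mathcal{V}'$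 is an atomic refinement of $\mathcal{V}$ if each multivector of $\mathcal{V}'$ is contained in a multivector of $\mathcal{V}$, $|\mathcal{V}\setminus\mathcal{V}'|=1$ and $|\mathcal{V}'\setminus\mathcal{V}|=2$. *)

theory Defs
  imports "HOL-Algebra.Elementary_Groups" "HOL-Library.Disjoint_Sets"
begin

section \<open>Finite simplicial complexes\<close>

text \<open>A finite abstract simplicial complex, given as the set of its nonempty simplices. A simplex is
  the set of its vertices, so that the face relation is inclusion.\<close>

definition finite_simplicial_complex :: "'a set set \<Rightarrow> bool" where
  "finite_simplicial_complex K \<longleftrightarrow>
     finite K \<and> (\<forall>\<sigma>\<in>K. finite \<sigma> \<and> \<sigma> \<noteq> {}) \<and> (\<forall>\<sigma>\<in>K. \<forall>\<tau>. \<tau> \<noteq> {} \<and> \<tau> \<subseteq> \<sigma> \<longrightarrow> \<tau> \<in> K)"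

definition simplex_cl :: "'a set set \<Rightarrow> 'a set \<Rightarrow> 'a set set" where
  "simplex_cl K \<sigma> = {\<tau> \<in> K. \<tau> \<subseteq> \<sigma>}"

definition cl :: "'a set set \<Rightarrow> 'a set set \<Rightarrow> 'a set set" where
  "cl K A = (\<Union>\<sigma>\<in>A. simplex_cl K \<sigma>)"

definition closed_subset :: "'a set set \<Rightarrow> 'a set set \<Rightarrow> bool" where
  "closed_subset K A \<longleftrightarrow> A \<subseteq> K \<and> A = cl K A"

definition mo :: "'a set set \<Rightarrow> 'a set set \<Rightarrow> 'a set set" where
  "mo K A = cl K A - A"

definition convex_subset :: "'a set set \<Rightarrow> 'a set set \<Rightarrow> bool" where
  "convex_subset K A \<longleftrightarrow>
     A \<subseteq> K \<and> (\<forall>\<sigma>\<in>A. \<forall>\<tau>\<in>A. \<forall>\<rho>\<in>K. \<sigma> \<subseteq> \<rho> \<and> \<rho> \<subseteq> \<tau> \<longrightarrow> \<rho> \<in> A)"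


section \<open>Relative simplicial homology with field coefficients\<close>

text \<open>
  Oriented simplicial chains. An \<open>n\<close>-chain of \<open>L\<close> is a function on the orderings
  \<open>[v\<^sub>0, \<dots>, v\<^sub>n]\<close> of the vertices of the \<open>n\<close>-simplices of \<open>L\<close> that changes its sign
  when two (adjacent) vertices are transposed; it is extended by \<open>0\<close> to all other lists. The
  oriented simplex \<open>[v\<^sub>0, \<dots>, v\<^sub>n]\<close> is the chain whose value is \<open>1\<close> at this list, the sign
  of the permutation at its permutations, and \<open>0\<close> elsewhere. No order on the vertices has to be
  chosen.
\<close>

definition simplicial_chains :: "nat \<Rightarrow> 'a set set \<Rightarrow> ('a list \<Rightarrow> 'f::field) set" where
  "simplicial_chains n L = {c.
     (\<forall>xs. c xs \<noteq> 0 \<longrightarrow> distinct xs \<and> length xs = Suc n \<and> set xs \<in> L) \<and>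
     (\<forall>us x y vs. c (us @ x # y # vs) = - c (us @ y # x # vs))}"

text \<open>
  The coefficient of \<open>[v\<^sub>1, \<dots>, v\<^sub>n]\<close> in the boundary of \<open>c\<close> is the sum of the coefficients of
  \<open>[v, v\<^sub>1, \<dots>, v\<^sub>n]\<close> in \<open>c\<close>. As moving a vertex over \<open>i\<close> others to the front gives the
  sign \<open>(- 1) ^ i\<close>, this maps the oriented simplex \<open>[v\<^sub>0, \<dots>, v\<^sub>n]\<close> to the alternating sum of its
  facets. The value at the empty list is \<open>0\<close> because homology is not reduced: all \<open>0\<close>-chains
  have boundary \<open>0\<close>.
\<close>

definition boundary :: "('a list \<Rightarrow> 'f::field) \<Rightarrow> 'a list \<Rightarrow> 'f" where
  "boundary c xs = (if xs = [] then 0 else \<Sum>v | c (v # xs) \<noteq> 0. c (v # xs))"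

text \<open>For \<open>n = 0\<close> the condition on the boundary below is void, since the boundary is then \<open>0\<close>.\<close>

definition relcycles :: "nat \<Rightarrow> 'a set set \<Rightarrow> 'a set set \<Rightarrow> ('a list \<Rightarrow> 'f::field) set" where
  "relcycles n L M = {c \<in> simplicial_chains n L. boundary c \<in> simplicial_chains (n - 1) M}"

definition relboundaries :: "nat \<Rightarrow> 'a set set \<Rightarrow> 'a set set \<Rightarrow> ('a list \<Rightarrow> 'f::field) set" where
  "relboundaries n L M =
     {(\<lambda>xs. boundary d xs + e xs) | d e. d \<in> simplicial_chains (Suc n) L \<and> e \<in> simplicial_chains n M}"

definition relcycle_group :: "nat \<Rightarrow> 'a set set \<Rightarrow> 'a set set \<Rightarrow> ('a list \<Rightarrow> 'f::field) monoid" where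
  "relcycle_group n L M =
     \<lparr>carrier = relcycles n L M, monoid.mult = (\<lambda>c d xs. c xs + d xs), one = (\<lambda>xs. 0)\<rparr>"

definition rel_homology_group ::
    "nat \<Rightarrow> 'a set set \<Rightarrow> 'a set set \<Rightarrow> ('a list \<Rightarrow> 'f::field) set monoid" where
  "rel_homology_group n L M = relcycle_group n L M Mod relboundaries n L M"

text \<open>The following lemmas show that the quotient is one of a commutative group by a subgroup.\<close>

lemma chains_supp:
  "c \<in> simplicial_chains n L \<Longrightarrow> c xs \<noteq> 0 \<Longrightarrow>
     distinct xs \<and> length xs = Suc n \<and> set xs \<in> L"
  unfolding simplicial_chains_def by blast

lemma chains_swap: "c \<in> simplicial_chains n L \<Longrightarrow> c (us @ x # y # vs) = - c (us @ y # x # vs)"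
  unfolding simplicial_chains_def by blast

lemma chains_mono: "M \<subseteq> L \<Longrightarrow> simplicial_chains n M \<subseteq> simplicial_chains n L"
  unfolding simplicial_chains_def by blast

lemma zero_in_chains: "(\<lambda>xs. 0) \<in> simplicial_chains n L"
  by (simp add: simplicial_chains_def)

lemma add_in_chains:
  "c \<in> simplicial_chains n L \<Longrightarrow> d \<in> simplicial_chains n L \<Longrightarrow>
     (\<lambda>xs. c xs + d xs) \<in> simplicial_chains n L"
  unfolding simplicial_chains_def mem_Collect_eq
  by (metis add.right_neutral minus_add_distrib)

lemma uminus_in_chains: "c \<in> simplicial_chains n L \<Longrightarrow> (\<lambda>xs. - c xs) \<in> simplicial_chains n L"
  unfolding simplicial_chains_def mem_Collect_eq neg_equal_0_iff_equal neg_equal_iff_equal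
  by blast

lemma boundary_eq_sum:
  assumes "finite_simplicial_complex L" "c \<in> simplicial_chains n L"
  shows "boundary c xs = (if xs = [] then 0 else \<Sum>v\<in>\<Union>L. c (v # xs))"
proof -
  have "finite (\<Union>L)"
    using assms(1) by (auto simp: finite_simplicial_complex_def)
  moreover have "{v. c (v # xs) \<noteq> 0} \<subseteq> \<Union>L"
  proof
    fix v
    assume "v \<in> {v. c (v # xs) \<noteq> 0}"
    then have "set (v # xs) \<in> L"
      using chains_supp[OF assms(2), of "v # xs"] by simp
    then show "v \<in> \<Union>L"
      by (rule UnionI) simp
  qed
  ultimately have "(\<Sum>v | c (v # xs) \<noteq> 0. c (v # xs)) = (\<Sum>v\<in>\<Union>L. c (v # xs))"
    by (intro sum.mono_neutral_left) auto
  then show ?thesis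
    by (simp add: boundary_def)
qed

lemma boundary_add:
  assumes "finite_simplicial_complex L" "c \<in> simplicial_chains n L" "d \<in> simplicial_chains n L"
  shows "boundary (\<lambda>xs. c xs + d xs) = (\<lambda>xs. boundary c xs + boundary d xs)"
  by (rule ext) (simp add: boundary_eq_sum[OF assms(1,2)] boundary_eq_sum[OF assms(1,3)]
      boundary_eq_sum[OF assms(1) add_in_chains[OF assms(2,3)]] sum.distrib)

lemma boundary_uminus: "boundary (\<lambda>xs. - c xs) = (\<lambda>xs. - boundary c xs)"
  by (rule ext) (simp add: boundary_def sum_negf)

lemma boundary_in_chains:
  assumes L: "finite_simplicial_complex L" and c: "c \<in> simplicial_chains (Suc n) L"
  shows "boundary c \<in> simplicial_chains n L"
proof -
  have "distinct xs \<and> length xs = Suc n \<and> set xs \<in> L" if nz: "boundary c xs \<noteq> 0" for xs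
  proof -
    have ne: "xs \<noteq> []"
      using nz by (auto simp: boundary_def)
    then have "(\<Sum>v | c (v # xs) \<noteq> 0. c (v # xs)) \<noteq> 0"
      using nz by (simp add: boundary_def)
    then obtain v where "c (v # xs) \<noteq> 0"
      by (metis (mono_tags, lifting) sum.neutral)
    then have v: "distinct (v # xs) \<and> length (v # xs) = Suc (Suc n) \<and> set (v # xs) \<in> L"
      by (rule chains_supp[OF c])
    moreover have "set xs \<noteq> {}" "set xs \<subseteq> set (v # xs)"
      using ne by auto
    ultimately have "set xs \<in> L"
      using L unfolding finite_simplicial_complex_def by blast
    then show ?thesis
      using v by simp
  qed
  moreover have "boundary c (us @ x # y # vs) = - boundary c (us @ y # x # vs)" for us x y vs
    using chains_swap[OF c, of "_ # us" x y vs]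
    by (simp add: boundary_eq_sum[OF L c] sum_negf)
  ultimately show ?thesis
    unfolding simplicial_chains_def by blast
qed

lemma sum_alternating:
  fixes g :: "'b \<Rightarrow> 'b \<Rightarrow> 'f::field"
  assumes "finite V" "\<And>v. g v v = 0" "\<And>v w. g v w = - g w v"
  shows "(\<Sum>v\<in>V. \<Sum>w\<in>V. g v w) = 0"
  using assms(1)
proof (induction V rule: finite_induct)
  case (insert x V)
  have "(\<Sum>v\<in>V. g v x) = - (\<Sum>v\<in>V. g x v)"
    unfolding sum_negf[symmetric] by (rule sum.cong[OF refl assms(3)])
  then show ?case
    using insert by (simp add: sum.distrib assms(2))
qed simp

lemma boundary_boundary:
  assumes L: "finite_simplicial_complex L" and c: "c \<in> simplicial_chains (Suc n) L"
  shows "boundary (boundary c) = (\<lambda>xs. 0)"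
proof (rule ext)
  fix xs
  have "(\<Sum>v\<in>\<Union>L. \<Sum>w\<in>\<Union>L. c (w # v # xs)) = 0"
  proof (rule sum_alternating)
    show "finite (\<Union>L)"
      using L by (auto simp: finite_simplicial_complex_def)
    show "c (v # v # xs) = 0" for v
      using chains_supp[OF c, of "v # v # xs"] by auto
    show "c (w # v # xs) = - c (v # w # xs)" for v w
      using chains_swap[OF c, of "[]" w v xs] by simp
  qed
  then show "boundary (boundary c) xs = 0"
    by (simp add: boundary_eq_sum[OF L boundary_in_chains[OF L c]] boundary_eq_sum[OF L c])
qed

lemma relboundariesI:
  "d \<in> simplicial_chains (Suc n) L \<Longrightarrow> e \<in> simplicial_chains n M \<Longrightarrow>
     (\<lambda>xs. boundary d xs + e xs) \<in> relboundaries n L M"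
  unfolding relboundaries_def by blast

lemma comm_group_relcycle_group:
  fixes L M :: "'a set set"
  assumes L: "finite_simplicial_complex L"
  shows "comm_group (relcycle_group n L M :: ('a list \<Rightarrow> 'f::field) monoid)"
proof (rule comm_groupI)
  let ?G = "relcycle_group n L M :: ('a list \<Rightarrow> 'f) monoid"
  show "x \<otimes>\<^bsub>?G\<^esub> y \<in> carrier ?G" if "x \<in> carrier ?G" "y \<in> carrier ?G" for x y
  proof -
    have x: "x \<in> simplicial_chains n L" "boundary x \<in> simplicial_chains (n - 1) M"
      and y: "y \<in> simplicial_chains n L" "boundary y \<in> simplicial_chains (n - 1) M"
      using that by (simp_all add: relcycle_group_def relcycles_def)
    show ?thesis
      using add_in_chains[OF x(1) y(1)] add_in_chains[OF x(2) y(2)]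
      by (simp add: relcycle_group_def relcycles_def boundary_add[OF L x(1) y(1)])
  qed
  show "\<one>\<^bsub>?G\<^esub> \<in> carrier ?G"
  proof -
    have "boundary (\<lambda>xs::'a list. 0::'f) = (\<lambda>xs. 0)"
      by (rule ext) (simp add: boundary_def)
    then show ?thesis
      by (simp add: relcycle_group_def relcycles_def zero_in_chains)
  qed
  show "\<exists>y\<in>carrier ?G. y \<otimes>\<^bsub>?G\<^esub> x = \<one>\<^bsub>?G\<^esub>" if "x \<in> carrier ?G" for x
  proof
    have x: "x \<in> simplicial_chains n L" "boundary x \<in> simplicial_chains (n - 1) M"
      using that by (simp_all add: relcycle_group_def relcycles_def)
    show "(\<lambda>xs. - x xs) \<in> carrier ?G"
      using uminus_in_chains[OF x(1)] uminus_in_chains[OF x(2)]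
      by (simp add: relcycle_group_def relcycles_def boundary_uminus)
    show "(\<lambda>xs. - x xs) \<otimes>\<^bsub>?G\<^esub> x = \<one>\<^bsub>?G\<^esub>"
      by (simp add: relcycle_group_def)
  qed
qed (simp_all add: relcycle_group_def add_ac)

lemma subgroup_relboundaries:
  fixes L M :: "'a set set"
  assumes L: "finite_simplicial_complex L" and M: "finite_simplicial_complex M" and sub_L: "M \<subseteq> L"
  shows "subgroup (relboundaries n L M :: ('a list \<Rightarrow> 'f::field) set) (relcycle_group n L M)"
proof -
  let ?G = "relcycle_group n L M :: ('a list \<Rightarrow> 'f) monoid"
  let ?B = "relboundaries n L M :: ('a list \<Rightarrow> 'f) set"
  interpret G: comm_group ?G
    by (rule comm_group_relcycle_group[OF L])
  have bd: "boundary e \<in> simplicial_chains (n - 1) M" if e: "e \<in> simplicial_chains n M" for e :: "'a list \<Rightarrow> 'f"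
  proof (cases n)
    case 0
    have "boundary e xs = 0" for xs
    proof (cases "xs = []")
      case False
      then have "e (v # xs) = 0" for v
        using chains_supp[OF e, of "v # xs"] 0 by auto
      then show ?thesis
        by (simp add: boundary_def)
    qed (simp add: boundary_def)
    then have "boundary e = (\<lambda>xs. 0)"
      by blast
    then show ?thesis
      by (simp add: zero_in_chains)
  next
    case (Suc m)
    then show ?thesis
      using boundary_in_chains[OF M] e by simp
  qed
  have sub: "(\<lambda>xs. boundary d xs + e xs) \<in> relcycles n L M"
    if d: "d \<in> simplicial_chains (Suc n) L" and e: "e \<in> simplicial_chains n M" for d e :: "'a list \<Rightarrow> 'f"
  proof -
    have eL: "e \<in> simplicial_chains n L"
      using e chains_mono[OF sub_L] by blast
    show ?thesis
      using add_in_chains[OF boundary_in_chains[OF L d] eL] bd[OF e]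
      by (simp add: relcycles_def boundary_add[OF L boundary_in_chains[OF L d] eL]
          boundary_boundary[OF L d])
  qed
  show ?thesis
  proof (rule G.subgroupI)
    show "?B \<subseteq> carrier ?G"
      using sub by (auto simp: relboundaries_def relcycle_group_def)
    show "?B \<noteq> {}"
      using zero_in_chains unfolding relboundaries_def by blast
    show "inv\<^bsub>?G\<^esub> x \<in> ?B" if x: "x \<in> ?B" for x
    proof -
      obtain d e where d: "d \<in> simplicial_chains (Suc n) L" and e: "e \<in> simplicial_chains n M"
        and xe: "x = (\<lambda>xs. boundary d xs + e xs)"
        using x by (auto simp: relboundaries_def)
      let ?y = "\<lambda>xs. boundary (\<lambda>xs. - d xs) xs + - e xs"
      have y: "?y \<in> ?B"
        by (rule relboundariesI[OF uminus_in_chains[OF d] uminus_in_chains[OF e]])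
      have "?y \<otimes>\<^bsub>?G\<^esub> x = \<one>\<^bsub>?G\<^esub>"
        by (simp add: relcycle_group_def xe boundary_uminus)
      moreover have "?y \<in> carrier ?G" "x \<in> carrier ?G"
        using sub[OF uminus_in_chains[OF d] uminus_in_chains[OF e]] sub[OF d e]
        by (simp_all add: relcycle_group_def xe)
      ultimately show ?thesis
        using y G.inv_equality by metis
    qed
    show "x \<otimes>\<^bsub>?G\<^esub> y \<in> ?B" if x: "x \<in> ?B" and y: "y \<in> ?B" for x y
    proof -
      obtain d e d' e' where d: "d \<in> simplicial_chains (Suc n) L" "d' \<in> simplicial_chains (Suc n) L"
        and e: "e \<in> simplicial_chains n M" "e' \<in> simplicial_chains n M"
        and xe: "x = (\<lambda>xs. boundary d xs + e xs)" "y = (\<lambda>xs. boundary d' xs + e' xs)"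
        using x y by (auto simp: relboundaries_def)
      have "x \<otimes>\<^bsub>?G\<^esub> y = (\<lambda>xs. boundary (\<lambda>xs. d xs + d' xs) xs + (e xs + e' xs))"
        unfolding boundary_add[OF L d] by (simp add: relcycle_group_def xe add_ac)
      then show ?thesis
        using relboundariesI[OF add_in_chains[OF d] add_in_chains[OF e]] by simp
    qed
  qed
qed


section \<open>Multivector fields\<close>

definition multivector :: "'a set set \<Rightarrow> 'a set set \<Rightarrow> bool" where
  "multivector K V \<longleftrightarrow> convex_subset K V"

definition multivector_field :: "'a set set \<Rightarrow> 'a set set set \<Rightarrow> bool" where
  "multivector_field K \<V> \<longleftrightarrow> partition_on K \<V> \<and> (\<forall>V\<in>\<V>. multivector K V)"

definition mv_of :: "'a set set set \<Rightarrow> 'a set \<Rightarrow> 'a set set" where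
  "mv_of \<V> \<sigma> = (THE V. V \<in> \<V> \<and> \<sigma> \<in> V)"

text \<open>The argument of type \<open>'f itself\<close>, here and below, selects the field of coefficients of the
  homology. \<open>H(cl V, mo V) \<noteq> 0\<close> means that it is nonzero in some degree.\<close>

definition critical :: "'f::{field,finite} itself \<Rightarrow> 'a set set \<Rightarrow> 'a set set \<Rightarrow> bool" where
  "critical F K V \<longleftrightarrow>
     (\<exists>n. \<not> trivial_group (rel_homology_group n (cl K V) (mo K V) :: ('a list \<Rightarrow> 'f) set monoid))"

definition compatible :: "'a set set set \<Rightarrow> 'a set set \<Rightarrow> bool" where
  "compatible \<V> A \<longleftrightarrow> (\<exists>\<W>\<subseteq>\<V>. A = \<Union>\<W>)"

definition atomic_refinement :: "'a set set set \<Rightarrow> 'a set set set \<Rightarrow> bool" where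
  "atomic_refinement \<V>' \<V> \<longleftrightarrow>
     (\<forall>V'\<in>\<V>'. \<exists>V\<in>\<V>. V' \<subseteq> V) \<and> card (\<V> - \<V>') = 1 \<and> card (\<V>' - \<V>) = 2"


section \<open>Dynamics\<close>

definition dyn :: "'a set set \<Rightarrow> 'a set set set \<Rightarrow> 'a set \<Rightarrow> 'a set set" where
  "dyn K \<V> \<sigma> = simplex_cl K \<sigma> \<union> mv_of \<V> \<sigma>"

definition dyn_set :: "'a set set \<Rightarrow> 'a set set set \<Rightarrow> 'a set set \<Rightarrow> 'a set set" where
  "dyn_set K \<V> A = (\<Union>\<sigma>\<in>A. dyn K \<V> \<sigma>)"

text \<open>Only the values of \<open>\<rho>\<close> at \<open>0, \<dots>, n\<close> matter for a path.\<close>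

definition is_path :: "'a set set \<Rightarrow> 'a set set set \<Rightarrow> nat \<Rightarrow> (nat \<Rightarrow> 'a set) \<Rightarrow> bool" where
  "is_path K \<V> n \<rho> \<longleftrightarrow> (\<forall>i\<le>n. \<rho> i \<in> K) \<and> (\<forall>i<n. \<rho> (Suc i) \<in> dyn K \<V> (\<rho> i))"

definition solution :: "'a set set \<Rightarrow> 'a set set set \<Rightarrow> (int \<Rightarrow> 'a set) \<Rightarrow> bool" where
  "solution K \<V> \<rho> \<longleftrightarrow> (\<forall>i. \<rho> i \<in> K) \<and> (\<forall>i. \<rho> (i + 1) \<in> dyn K \<V> (\<rho> i))"

definition essential ::
    "'f::{field,finite} itself \<Rightarrow> 'a set set \<Rightarrow> 'a set set set \<Rightarrow> (int \<Rightarrow> 'a set) \<Rightarrow> bool" where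
  "essential F K \<V> \<rho> \<longleftrightarrow> solution K \<V> \<rho> \<and>
     (\<forall>i. \<not> critical F K (mv_of \<V> (\<rho> i)) \<longrightarrow>
        (\<exists>i1 i2. i1 < i \<and> i < i2 \<and>
           mv_of \<V> (\<rho> i1) \<noteq> mv_of \<V> (\<rho> i) \<and> mv_of \<V> (\<rho> i) \<noteq> mv_of \<V> (\<rho> i2)))"

definition Inv ::
    "'f::{field,finite} itself \<Rightarrow> 'a set set \<Rightarrow> 'a set set set \<Rightarrow> 'a set set \<Rightarrow> 'a set set" where
  "Inv F K \<V> A = {\<sigma> \<in> A. \<exists>\<rho>. essential F K \<V> \<rho> \<and> range \<rho> \<subseteq> A \<and> (\<exists>i. \<rho> i = \<sigma>)}"

definition invariant_set ::
    "'f::{field,finite} itself \<Rightarrow> 'a set set \<Rightarrow> 'a set set set \<Rightarrow> 'a set set \<Rightarrow> bool" where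
  "invariant_set F K \<V> S \<longleftrightarrow> S \<subseteq> K \<and> S = Inv F K \<V> S"

definition isolating_set ::
    "'a set set \<Rightarrow> 'a set set set \<Rightarrow> 'a set set \<Rightarrow> 'a set set \<Rightarrow> bool" where
  "isolating_set K \<V> N S \<longleftrightarrow> closed_subset K N \<and> dyn_set K \<V> S \<subseteq> N \<and>
     (\<forall>n \<rho>. is_path K \<V> n \<rho> \<and> (\<forall>i\<le>n. \<rho> i \<in> N) \<and> \<rho> 0 \<in> S \<and> \<rho> n \<in> S \<longrightarrow> (\<forall>i\<le>n. \<rho> i \<in> S))"

definition isolated_invariant_set ::
    "'f::{field,finite} itself \<Rightarrow> 'a set set \<Rightarrow> 'a set set set \<Rightarrow> 'a set set \<Rightarrow> bool" where
  "isolated_invariant_set F K \<V> S \<longleftrightarrow> invariant_set F K \<V> S \<and> (\<exists>N. isolating_set K \<V> N S)"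

definition index_pair ::
    "'f::{field,finite} itself \<Rightarrow> 'a set set \<Rightarrow> 'a set set set \<Rightarrow> 'a set set \<Rightarrow> 'a set set
      \<Rightarrow> 'a set set \<Rightarrow> bool" where
  "index_pair F K \<V> P E S \<longleftrightarrow>
     isolated_invariant_set F K \<V> S \<and>
     closed_subset K P \<and> closed_subset K E \<and> E \<subseteq> P \<and>
     dyn_set K \<V> (P - E) \<subseteq> P \<and>
     dyn_set K \<V> E \<inter> P \<subseteq> E \<and>
     S = Inv F K \<V> (P - E)"

end

(* Every multivector of V is a union of multivectors of the refinement V', so A is V'-compatible as
   well, and it suffices to treat one field for which A is compatible. As A is convex, mo(A) is
   closed, and by compatibility no trajectory in cl(A) returns from mo(A) to A. Hence a path in cl(A)
   with endpoints in Inv(A) stays in A; prolonged at both ends by essential solutions, it becomes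
   an essential solution in A. *)

theory Submission
  imports Defs
begin

section \<open>Partitions and compatible sets\<close>

lemma partition_on_part_unique:
  assumes "partition_on K \<V>" "V \<in> \<V>" "W \<in> \<V>" "x \<in> V" "x \<in> W"
  shows "V = W"
  using disjointD[OF partition_onD2[OF assms(1)] assms(2,3)] assms(4,5) by blast

lemma mv_of_eq:
  assumes "partition_on K \<V>" "V \<in> \<V>" "x \<in> V"
  shows "mv_of \<V> x = V"
  unfolding mv_of_def
proof (rule the_equality)
  fix W
  assume "W \<in> \<V> \<and> x \<in> W"
  then show "W = V"
    using partition_on_part_unique[OF assms(1)] assms(2,3) by blast
qed (use assms in simp)

text \<open>Distinct multivectors are disjoint, so a multivector that meets \<open>A\<close> is
  itself one of those whose union is \<open>A\<close>. Hence moving inside a multivector neither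
  enters nor leaves \<open>A\<close>.\<close>

lemma mv_of_mem_iff_compatible:
  assumes part: "partition_on K \<V>" and "compatible \<V> A" "x \<in> K" "y \<in> mv_of \<V> x"
  shows "y \<in> A \<longleftrightarrow> x \<in> A"
proof -
  obtain V where V: "V \<in> \<V>" "x \<in> V"
    using partition_onD1[OF part] assms(3) by blast
  then have y: "y \<in> V"
    using mv_of_eq[OF part V] assms(4) by simp
  obtain \<W> where W: "\<W> \<subseteq> \<V>" "A = \<Union>\<W>"
    using assms(2) unfolding compatible_def by blast
  have "V \<in> \<W>" if "z \<in> V" "z \<in> A" for z
  proof -
    obtain W where "W \<in> \<W>" "z \<in> W"
      using W(2) \<open>z \<in> A\<close> by blast
    then show ?thesis
      using partition_on_part_unique[OF part V(1) _ \<open>z \<in> V\<close>] W(1) by blast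
  qed
  then show ?thesis
    using V(2) y W(2) by blast
qed

text \<open>The witness is the family of all members of \<open>\<V>'\<close> contained in
  \<open>A\<close>. It covers \<open>A\<close>: the member of \<open>\<V>\<close> around a fine
  multivector that meets \<open>A\<close> is one of the multivectors making up \<open>A\<close>, so
  the fine one lies in \<open>A\<close> too.\<close>

lemma compatible_refinement:
  assumes part: "partition_on K \<V>" and part': "partition_on K \<V>'"
    and ref: "\<forall>V'\<in>\<V>'. \<exists>V\<in>\<V>. V' \<subseteq> V" and "A \<subseteq> K" "compatible \<V> A"
  shows "compatible \<V>' A"
proof -
  obtain \<W> where W: "\<W> \<subseteq> \<V>" "A = \<Union>\<W>"
    using \<open>compatible \<V> A\<close> unfolding compatible_def by blast
  have "x \<in> \<Union>{V' \<in> \<V>'. V' \<subseteq> A}" if x: "x \<in> A" for x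
  proof -
    obtain V' where V': "V' \<in> \<V>'" "x \<in> V'"
      using partition_onD1[OF part'] assms(4) x by blast
    obtain V where V: "V \<in> \<V>" "V' \<subseteq> V"
      using ref V' by blast
    obtain W where "W \<in> \<W>" "x \<in> W"
      using W(2) x by blast
    moreover have "V = W"
      using partition_on_part_unique[OF part V(1)] V(2) V'(2) W(1) calculation by blast
    ultimately show ?thesis
      using V(2) V' W(2) by blast
  qed
  then have "A \<subseteq> \<Union>{V' \<in> \<V>'. V' \<subseteq> A}"
    by (rule subsetI)
  moreover have "\<Union>{V' \<in> \<V>'. V' \<subseteq> A} \<subseteq> A"
    by blast
  ultimately have "A = \<Union>{V' \<in> \<V>'. V' \<subseteq> A}"
    by (rule equalityI)
  then show ?thesis
    unfolding compatible_def by (intro exI conjI) (rule Collect_restrict)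
qed

section \<open>Closure and mouth\<close>

lemma subset_cl: "A \<subseteq> K \<Longrightarrow> A \<subseteq> cl K A"
  by (auto simp: cl_def simplex_cl_def)

lemma mem_cl_iff: "\<rho> \<in> cl K A \<longleftrightarrow> \<rho> \<in> K \<and> (\<exists>\<tau>\<in>A. \<rho> \<subseteq> \<tau>)"
  by (auto simp: cl_def simplex_cl_def)

lemma closed_subsetI:
  assumes "A \<subseteq> K" "\<And>\<rho> \<tau>. \<rho> \<in> K \<Longrightarrow> \<tau> \<in> A \<Longrightarrow> \<rho> \<subseteq> \<tau> \<Longrightarrow> \<rho> \<in> A"
  shows "closed_subset K A"
  unfolding closed_subset_def
proof
  have "cl K A \<subseteq> A"
    using assms(2) mem_cl_iff[of _ K A] by blast
  then show "A = cl K A"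
    using subset_cl[OF assms(1)] by (rule equalityI[rotated])
qed (rule assms(1))

lemma closed_subset_cl: "closed_subset K (cl K A)"
proof (rule closed_subsetI)
  show "\<rho> \<in> cl K A" if "\<rho> \<in> K" "\<tau> \<in> cl K A" "\<rho> \<subseteq> \<tau>" for \<rho> \<tau>
    using that unfolding mem_cl_iff by (meson order_trans)
qed (auto simp: mem_cl_iff)

text \<open>If a face \<open>\<rho>\<close> of \<open>\<tau>\<close> in the mouth were in
  \<open>A\<close>, then \<open>\<tau>\<close> would lie between two simplices of \<open>A\<close>,
  and convexity would put it in \<open>A\<close>.\<close>

lemma closed_subset_mo:
  assumes "convex_subset K A"
  shows "closed_subset K (mo K A)"
proof (rule closed_subsetI)
  show "\<rho> \<in> mo K A" if "\<rho> \<in> K" and \<tau>: "\<tau> \<in> mo K A" and "\<rho> \<subseteq> \<tau>" for \<rho> \<tau>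
  proof -
    obtain \<sigma> where \<sigma>: "\<sigma> \<in> A" "\<tau> \<subseteq> \<sigma>" "\<tau> \<in> K" "\<tau> \<notin> A"
      using \<tau> by (auto simp: mo_def mem_cl_iff)
    have "\<rho> \<notin> A"
      using assms \<sigma> \<open>\<rho> \<subseteq> \<tau>\<close> unfolding convex_subset_def by metis
    moreover have "\<rho> \<subseteq> \<sigma>"
      using \<open>\<rho> \<subseteq> \<tau>\<close> \<open>\<tau> \<subseteq> \<sigma>\<close> by (rule order_trans)
    ultimately show ?thesis
      using \<sigma>(1) \<open>\<rho> \<in> K\<close> by (auto simp: mo_def mem_cl_iff)
  qed
qed (auto simp: mo_def mem_cl_iff)

section \<open>Gluing essential solutions\<close>

text \<open>Essentiality can be read off the two tails: a solution that never left its multivector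
  before (or after) time \<open>i\<close> would carry this multivector into a tail, where
  \<open>\<alpha>\<close> (or \<open>\<beta>\<close>) has to leave it.\<close>

lemma essential_glue:
  fixes F :: "'f::{field,finite} itself" and m n :: int
  assumes sol: "solution K \<V> \<rho>" and "essential F K \<V> \<alpha>" "essential F K \<V> \<beta>"
    and past: "\<And>i. i \<le> m \<Longrightarrow> \<rho> i = \<alpha> (i + a)"
    and fut: "\<And>i. n \<le> i \<Longrightarrow> \<rho> i = \<beta> (i + b)"
  shows "essential F K \<V> \<rho>"
proof -
  have "\<exists>j<i. mv_of \<V> (\<rho> j) \<noteq> mv_of \<V> (\<rho> i)"
    if nc: "\<not> critical F K (mv_of \<V> (\<rho> i))" for i
  proof (cases "mv_of \<V> (\<rho> (min i m)) = mv_of \<V> (\<rho> i)")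
    case True
    define k where "k = min i m"
    have "\<rho> k = \<alpha> (k + a)"
      by (rule past) (simp add: k_def)
    \<comment> \<open>Criticality depends only on the multivector, so \<open>\<alpha>\<close> is in
      a noncritical one at time \<open>k + a\<close> as well. The time \<open>j\<close> is measured
      along \<open>\<alpha>\<close>; along \<open>\<rho>\<close> it is \<open>j - a\<close>.\<close>
    then obtain j where j: "j < k + a" "mv_of \<V> (\<alpha> j) \<noteq> mv_of \<V> (\<rho> i)"
      using assms(2) True nc unfolding essential_def k_def by metis
    have "\<rho> (j - a) = \<alpha> j"
      using past[of "j - a"] j(1) by (simp add: k_def)
    then show ?thesis
      using j by (intro exI[of _ "j - a"]) (simp add: k_def)
  next
    case False
    then show ?thesis
      \<comment> \<open>The multivectors differ, so \<open>min i m\<close> is not \<open>i\<close>;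
        it is \<open>m < i\<close> and serves as the earlier time.\<close>
      by (intro exI[of _ "min i m"]) (auto simp: min_def split: if_splits)
  qed
  moreover have "\<exists>j>i. mv_of \<V> (\<rho> i) \<noteq> mv_of \<V> (\<rho> j)"
    if nc: "\<not> critical F K (mv_of \<V> (\<rho> i))" for i
  proof (cases "mv_of \<V> (\<rho> (max i n)) = mv_of \<V> (\<rho> i)")
    case True
    define k where "k = max i n"
    have "\<rho> k = \<beta> (k + b)"
      by (rule fut) (simp add: k_def)
    then obtain j where j: "k + b < j" "mv_of \<V> (\<rho> i) \<noteq> mv_of \<V> (\<beta> j)"
      using assms(3) True nc unfolding essential_def k_def by metis
    have "\<rho> (j - b) = \<beta> j"
      using fut[of "j - b"] j(1) by (simp add: k_def)
    then show ?thesis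
      using j by (intro exI[of _ "j - b"]) (simp add: k_def)
  next
    case False
    then show ?thesis
      by (intro exI[of _ "max i n"]) (auto simp: max_def split: if_splits)
  qed
  ultimately show ?thesis
    using sol unfolding essential_def by blast
qed

lemma path_in_Inv:
  fixes F :: "'f::{field,finite} itself"
  assumes path: "is_path K \<V> n \<rho>" and inA: "\<forall>i\<le>n. \<rho> i \<in> A"
    and ends: "\<rho> 0 \<in> Inv F K \<V> A" "\<rho> n \<in> Inv F K \<V> A" and "i \<le> n"
  shows "\<rho> i \<in> Inv F K \<V> A"
proof -
  obtain \<alpha> a where \<alpha>: "essential F K \<V> \<alpha>" "range \<alpha> \<subseteq> A" "\<alpha> a = \<rho> 0"
    using ends(1) unfolding Inv_def by blast
  obtain \<beta> b where \<beta>: "essential F K \<V> \<beta>" "range \<beta> \<subseteq> A" "\<beta> b = \<rho> n"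
    using ends(2) unfolding Inv_def by blast
  have sol\<alpha>: "solution K \<V> \<alpha>" and sol\<beta>: "solution K \<V> \<beta>"
    using \<alpha>(1) \<beta>(1) by (simp_all add: essential_def)
  \<comment> \<open>Times are shifted so that \<open>\<alpha>\<close> reaches
    \<open>\<rho> 0\<close> at time 0 and \<open>\<beta>\<close> leaves \<open>\<rho> n\<close> at
    time \<open>int n\<close>.\<close>
  define \<tau> where
    "\<tau> j = (if j < 0 then \<alpha> (j + a) else if j \<le> int n then \<rho> (nat j) else \<beta> (j - int n + b))" for j
  \<comment> \<open>The pieces agree at the seams 0 and \<open>int n\<close>, so these times belong
    to both neighbours and each single step of \<open>\<tau>\<close> lies within one piece.\<close>
  have past: "\<tau> j = \<alpha> (j + a)" if "j \<le> 0" for j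
    using that \<alpha>(3) by (cases "j = 0") (auto simp: \<tau>_def)
  have fut: "\<tau> j = \<beta> (j + (b - int n))" if "int n \<le> j" for j
    using that \<beta>(3) by (cases "j = int n") (auto simp: \<tau>_def algebra_simps)
  have mid: "\<tau> (int k) = \<rho> k" if "k \<le> n" for k
    using that by (simp add: \<tau>_def)
  have ran: "\<tau> j \<in> A" for j
    using \<alpha>(2) \<beta>(2) inA by (auto simp: \<tau>_def)
  have "\<tau> j \<in> K" for j
    using sol\<alpha> sol\<beta> path by (auto simp: \<tau>_def solution_def is_path_def)
  moreover have "\<tau> (j + 1) \<in> dyn K \<V> (\<tau> j)" for j
  proof -
    consider "j < 0" | "0 \<le> j" "j < int n" | "int n \<le> j"
      by linarith
    then show ?thesis
    proof cases
      case 1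
      have "\<alpha> (j + a + 1) \<in> dyn K \<V> (\<alpha> (j + a))"
        using sol\<alpha> by (simp add: solution_def)
      then show ?thesis
        using 1 past[of j] past[of "j + 1"] by (simp add: algebra_simps)
    next
      case 2
      then obtain k where k: "j = int k" "k < n"
        using nonneg_int_cases by (metis of_nat_less_iff)
      have "\<rho> (Suc k) \<in> dyn K \<V> (\<rho> k)"
        using path k(2) by (simp add: is_path_def)
      then show ?thesis
        using k mid[of k] mid[of "Suc k"] by (simp add: algebra_simps)
    next
      case 3
      have "\<beta> (j + (b - int n) + 1) \<in> dyn K \<V> (\<beta> (j + (b - int n)))"
        using sol\<beta> by (simp add: solution_def)
      then show ?thesis
        using 3 fut[of j] fut[of "j + 1"] by (simp add: algebra_simps)
    qed
  qed
  ultimately have "solution K \<V> \<tau>"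
    by (simp add: solution_def)
  then have "essential F K \<V> \<tau>"
    by (rule essential_glue[OF _ \<alpha>(1) \<beta>(1) past fut])
  then show ?thesis
    using ran inA mid[OF \<open>i \<le> n\<close>] \<open>i \<le> n\<close> unfolding Inv_def by blast
qed

section \<open>Invariant sets and index pairs\<close>

text \<open>An essential solution in \<open>A\<close> witnesses the membership of every simplex it
  visits, so it already runs inside \<open>Inv F K \<V> A\<close>.\<close>

lemma invariant_set_Inv:
  assumes "A \<subseteq> K"
  shows "invariant_set F K \<V> (Inv F K \<V> A)"
proof -
  have "\<sigma> \<in> Inv F K \<V> (Inv F K \<V> A)" if \<sigma>: "\<sigma> \<in> Inv F K \<V> A" for \<sigma>
  proof -
    obtain \<rho> i where \<rho>: "essential F K \<V> \<rho>" "range \<rho> \<subseteq> A" "\<rho> i = \<sigma>"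
      using \<sigma> unfolding Inv_def by blast
    then have "range \<rho> \<subseteq> Inv F K \<V> A"
      unfolding Inv_def by blast
    then show ?thesis
      using \<sigma> \<rho> unfolding Inv_def[of F K \<V> "Inv F K \<V> A"] by blast
  qed
  moreover have "Inv F K \<V> B \<subseteq> B" for B
    by (auto simp: Inv_def)
  ultimately show ?thesis
    using assms unfolding invariant_set_def by blast
qed

lemma index_pair_cl_mo:
  fixes F :: "'f::{field,finite} itself"
  assumes part: "partition_on K \<V>" and comp: "compatible \<V> A" and conv: "convex_subset K A"
  shows "index_pair F K \<V> (cl K A) (mo K A) (Inv F K \<V> A)"
proof -
  have AK: "A \<subseteq> K"
    using conv by (simp add: convex_subset_def)
  have clK: "cl K A \<subseteq> K"
    by (auto simp: cl_def simplex_cl_def)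
  note mv = mv_of_mem_iff_compatible[OF part comp]
  \<comment> \<open>This makes the third condition on an index pair an identity.\<close>
  have diff: "cl K A - mo K A = A"
    using subset_cl[OF AK] by (auto simp: mo_def)
  have dynA: "dyn K \<V> \<sigma> \<subseteq> cl K A" if "\<sigma> \<in> A" for \<sigma>
    using that mv[of \<sigma>] AK subset_cl[OF AK] by (auto simp: dyn_def cl_def)
  \<comment> \<open>Faces of \<open>\<sigma>\<close> stay in the closed mouth, and its multivector
    misses \<open>A\<close> by compatibility: the mouth has no way back into
    \<open>A\<close>.\<close>
  have dynmo: "dyn K \<V> \<sigma> \<inter> A = {}" if "\<sigma> \<in> mo K A" for \<sigma>
  proof -
    have "simplex_cl K \<sigma> \<subseteq> mo K A"
      using that closed_subset_mo[OF conv] by (auto simp: closed_subset_def cl_def)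
    moreover have "\<sigma> \<in> K" "\<sigma> \<notin> A"
      using that clK by (auto simp: mo_def)
    ultimately show ?thesis
      using mv[of \<sigma>] by (auto simp: dyn_def mo_def)
  qed
  have InvA: "Inv F K \<V> A \<subseteq> A"
    by (auto simp: Inv_def)
  have stay: "\<rho> i \<in> Inv F K \<V> A"
    if path: "is_path K \<V> n \<rho>" and inN: "\<forall>i\<le>n. \<rho> i \<in> cl K A"
      and ends: "\<rho> 0 \<in> Inv F K \<V> A" "\<rho> n \<in> Inv F K \<V> A" and "i \<le> n" for n \<rho> i
  proof -
    have "\<rho> j \<in> A" if "j \<le> n" for j
      using that
    \<comment> \<open>The induction runs backwards from \<open>n\<close>: a predecessor of a point
      of \<open>A\<close> cannot lie in the mouth, and it lies in \<open>cl K A\<close>, hence in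
      \<open>A\<close>.\<close>
    proof (induction j rule: inc_induct)
      case base
      then show ?case
        using ends(2) InvA by blast
    next
      case (step j)
      then have "\<rho> (Suc j) \<in> dyn K \<V> (\<rho> j)" "\<rho> j \<in> cl K A"
        using path inN by (simp_all add: is_path_def)
      then show ?case
        using step.IH dynmo[of "\<rho> j"] by (auto simp: mo_def)
    qed
    then show ?thesis
      using path_in_Inv[OF path _ ends \<open>i \<le> n\<close>] by blast
  qed
  \<comment> \<open>The closure of \<open>A\<close> itself serves as the isolating set.\<close>
  have "isolating_set K \<V> (cl K A) (Inv F K \<V> A)"
    unfolding isolating_set_def dyn_set_def
    using closed_subset_cl dynA InvA stay by blast
  then have "isolated_invariant_set F K \<V> (Inv F K \<V> A)"
    using invariant_set_Inv[OF AK] unfolding isolated_invariant_set_def by blast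
  moreover have "dyn_set K \<V> A \<subseteq> cl K A" "dyn_set K \<V> (mo K A) \<inter> cl K A \<subseteq> mo K A"
    using dynA dynmo by (auto simp: dyn_set_def mo_def)
  ultimately show ?thesis
    using closed_subset_cl closed_subset_mo[OF conv]
    unfolding index_pair_def diff by (auto simp: mo_def)
qed

theorem theorem12:
  fixes K A :: "'a set set" and \<V> \<V>' :: "'a set set set"
  assumes "finite_simplicial_complex K"
    and "multivector_field K \<V>" and "multivector_field K \<V>'"
    and "atomic_refinement \<V>' \<V>"
    and "A \<subseteq> K" and "compatible \<V> A" and "convex_subset K A"
  shows "index_pair TYPE('f::{field,finite}) K \<V> (cl K A) (mo K A) (Inv TYPE('f) K \<V> A) \<and>
         index_pair TYPE('f) K \<V>' (cl K A) (mo K A) (Inv TYPE('f) K \<V>' A)"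
proof -
  have part: "partition_on K \<V>" and part': "partition_on K \<V>'"
    using assms by (simp_all add: multivector_field_def)
  have "\<forall>V'\<in>\<V>'. \<exists>V\<in>\<V>. V' \<subseteq> V"
    using assms by (simp add: atomic_refinement_def)
  \<comment> \<open>Convexity of \<open>A\<close> refers only to \<open>K\<close>, so compatibility
    is all that has to be transferred to the refinement.\<close>
  then have "compatible \<V>' A"
    by (rule compatible_refinement[OF part part' _ \<open>A \<subseteq> K\<close> \<open>compatible \<V> A\<close>])
  then show ?thesis
    using index_pair_cl_mo[OF part] index_pair_cl_mo[OF part'] assms(6,7) by blast
qed

end
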